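(* Let $N\ge1$, let $\Omega\subset\mathbb{R}^N$ be a bounded domain with smooth boundary, let $\sigma\in(0,1)$ and $p\in(2,\infty)$. Let $\lambda_1(\sigma)$ be the first eigenvalue of the fractional Dirichlet Laplacian of order $\sigma$ on $\Omega$. If $\lambda_1(\sigma)\ge1$, then the problem $$(-\Delta)^\sigma u+|u|^{p-1}\operatorname{sign}u-u=0\ \text{ in }\Omega,\qquad u=0\ \text{ in }\mathbb{R}^N\setminus\Omega,$$ admits only the trivial weak solution $u\equiv0$.
   Context: For $r\in(0,1)$, $C(r):=\left(\int_{\mathbb{R}^N}\frac{1-\cos\zeta_1}{|\zeta|^{N+2r}}\,d\zeta\right)^{-1}$, $\mathcal{X}_{r,0}:=\{v\in H^r(\mathbb{R}^N): v=0\text{ a.e. in }\mathbb{R}^N\setminus\Omega\}$ with norm $\|v\|_{\mathcal{X}_{r,0}}^2:=\frac{C(r)}2\iint_{\mathbb{R}^{2N}}\frac{|v(x)-v(y)|^2}{|x-y|^{N+2r}}\,dx\,dy$, and $\lambda_1(r):=\min\{\|v\|_{\mathcal{X}_{r,0}}^2: v\in\mathcal{X}_{r,0},\ \|v\|_{L^2(\Omega)}=1\}$. $\mathcal{E}_\sigma:=\mathcal{X}_{\sigma,0}\cap L^p(\mathbb{R}^N)$, $\beta(v):=|v|^{p-1}\operatorname{sign}v$. A function $u\in\mathcal{E}_\sigma$ is a weak solution of the problem if for all $\varphi\in\mathcal{E}_\sigma$ $$\frac{C(\sigma)}2\iint_{\mathbb{R}^{2N}}\frac{(u(x)-u(y))(\varphi(x)-\varphi(y))}{|x-y|^{N+2\sigma}}\,dx\,dy+\int_\Omega\beta(u)\varphi\,dx-\int_\Omega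 u\varphi\,dx=0.$$ *)

theory Defs
  imports "HOL-Analysis.Analysis"
begin

text \<open>
  The space \<open>\<real>\<^sup>N\<close>, \<open>N \<ge> 1\<close>, is an arbitrary type \<open>'a :: euclidean_space\<close> with \<open>N = DIM('a)\<close>, and
  \<open>\<real>\<^sup>2\<^sup>N\<close> is \<open>'a \<times> 'a\<close>. Elements of the function spaces are honest functions, and equality of
  elements is equality almost everywhere with respect to Lebesgue measure.
\<close>

subsection \<open>Bounded domains with smooth boundary\<close>

text \<open>On the whole space, \<open>f\<close> is \<open>C\<^sup>k\<^sup>+\<^sup>1\<close> iff it is differentiable and all its first
  partial derivatives are \<open>C\<^sup>k\<close>.\<close>

primrec Ck :: "nat \<Rightarrow> ('a::euclidean_space \<Rightarrow> real) \<Rightarrow> bool" where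
  "Ck 0 f \<longleftrightarrow> continuous_on UNIV f"
| "Ck (Suc k) f \<longleftrightarrow>
     f differentiable_on UNIV \<and> (\<forall>b\<in>Basis. Ck k (\<lambda>x. frechet_derivative f (at x) b))"

definition smooth :: "('a::euclidean_space \<Rightarrow> real) \<Rightarrow> bool" where
  "smooth f \<longleftrightarrow> (\<forall>k. Ck k f)"

text \<open>Near each boundary point, \<open>\<Omega>\<close> is the region strictly above the graph of a smooth function
  of the \<open>N - 1\<close> variables orthogonal to some unit direction \<open>e\<close>. Such a function is represented
  by a smooth \<open>\<gamma>\<close> on the whole space which is invariant under translations along \<open>e\<close>.\<close>

definition smooth_boundary :: "'a::euclidean_space set \<Rightarrow> bool" where
  "smooth_boundary \<Omega> \<longleftrightarrow>
     (\<forall>x0 \<in> frontier \<Omega>. \<exists>r>0. \<exists>e. \<exists>\<gamma>.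
        norm e = 1 \<and> smooth \<gamma> \<and> (\<forall>x t. \<gamma> (x + t *\<^sub>R e) = \<gamma> x) \<and>
        \<Omega> \<inter> ball x0 r = {x \<in> ball x0 r. x \<bullet> e > \<gamma> x})"

definition bounded_smooth_domain :: "'a::euclidean_space set \<Rightarrow> bool" where
  "bounded_smooth_domain \<Omega> \<longleftrightarrow>
     open \<Omega> \<and> connected \<Omega> \<and> \<Omega> \<noteq> {} \<and> bounded \<Omega> \<and> smooth_boundary \<Omega>"

subsection \<open>The fractional Dirichlet Laplacian\<close>

text \<open>The first coordinate of \<open>\<zeta>\<close> is taken with respect to an arbitrarily chosen standard basis
  vector; by symmetry the value does not depend on this choice.\<close>

definition frac_const :: "'a::euclidean_space itself \<Rightarrow> real \<Rightarrow> real" where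
  "frac_const _ r =
     inverse (LINT \<zeta>|lebesgue.
       (1 - cos ((\<zeta>::'a) \<bullet> (SOME b. b \<in> Basis))) / norm \<zeta> powr (real DIM('a) + 2 * r))"

text \<open>The integrands below vanish on the diagonal \<open>x = y\<close> by the convention \<open>a / 0 = 0\<close>; the
  diagonal is a null set.\<close>

definition frac_form :: "real \<Rightarrow> ('a::euclidean_space \<Rightarrow> real) \<Rightarrow> ('a \<Rightarrow> real) \<Rightarrow> real" where
  "frac_form r u \<phi> =
     frac_const TYPE('a) r / 2 *
       (LINT z|lebesgue. (case z of (x, y) \<Rightarrow>
          (u x - u y) * (\<phi> x - \<phi> y) / norm (x - y) powr (real DIM('a) + 2 * r)))"

definition Hr :: "real \<Rightarrow> ('a::euclidean_space \<Rightarrow> real) set" where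
  "Hr r = {v. v \<in> borel_measurable lebesgue \<and>
      integrable lebesgue (\<lambda>x. (v x)\<^sup>2) \<and>
      integrable lebesgue (\<lambda>(x, y). \<bar>v x - v y\<bar>\<^sup>2 / norm (x - y) powr (real DIM('a) + 2 * r))}"

definition X0 :: "'a::euclidean_space set \<Rightarrow> real \<Rightarrow> ('a \<Rightarrow> real) set" where
  "X0 \<Omega> r = {v \<in> Hr r. AE x in lebesgue. x \<notin> \<Omega> \<longrightarrow> v x = 0}"

definition X0_norm :: "real \<Rightarrow> ('a::euclidean_space \<Rightarrow> real) \<Rightarrow> real" where
  "X0_norm r v =
     sqrt (frac_const TYPE('a) r / 2 *
       (LINT z|lebesgue. (case z of (x, y) \<Rightarrow>
          \<bar>v x - v y\<bar>\<^sup>2 / norm (x - y) powr (real DIM('a) + 2 * r))))"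

definition L2_norm_on :: "'a::euclidean_space set \<Rightarrow> ('a \<Rightarrow> real) \<Rightarrow> real" where
  "L2_norm_on \<Omega> v = sqrt (LINT x:\<Omega>|lebesgue. (v x)\<^sup>2)"

text \<open>The first eigenvalue is the minimum of this set. The minimum is attained, so it is the
  infimum; the set is bounded below by \<open>0\<close>.\<close>

definition lambda1 :: "'a::euclidean_space set \<Rightarrow> real \<Rightarrow> real" where
  "lambda1 \<Omega> r = Inf {(X0_norm r v)\<^sup>2 | v. v \<in> X0 \<Omega> r \<and> L2_norm_on \<Omega> v = 1}"

subsection \<open>Weak solutions\<close>

definition E_space :: "'a::euclidean_space set \<Rightarrow> real \<Rightarrow> real \<Rightarrow> ('a \<Rightarrow> real) set" where
  "E_space \<Omega> \<sigma> p = {v \<in> X0 \<Omega> \<sigma>. integrable lebesgue (\<lambda>x. \<bar>v x\<bar> powr p)}"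

definition beta :: "real \<Rightarrow> real \<Rightarrow> real" where
  "beta p s = \<bar>s\<bar> powr (p - 1) * sgn s"

definition weak_solution :: "'a::euclidean_space set \<Rightarrow> real \<Rightarrow> real \<Rightarrow> ('a \<Rightarrow> real) \<Rightarrow> bool" where
  "weak_solution \<Omega> \<sigma> p u \<longleftrightarrow>
     u \<in> E_space \<Omega> \<sigma> p \<and>
     (\<forall>\<phi> \<in> E_space \<Omega> \<sigma> p.
        frac_form \<sigma> u \<phi> + (LINT x:\<Omega>|lebesgue. beta p (u x) * \<phi> x)
          - (LINT x:\<Omega>|lebesgue. u x * \<phi> x) = 0)"

end

theory Submission
  imports Defs
begin

text \<open>
  Testing the equation with \<open>\<phi> = u\<close> gives
  \<open>\<parallel>u\<parallel>\<^sup>2\<^sub>X + \<integral>\<^sub>\<Omega> |u|\<^sup>p = \<integral>\<^sub>\<Omega> u\<^sup>2\<close>, while the Rayleigh quotient bound gives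
  \<open>\<parallel>u\<parallel>\<^sup>2\<^sub>X \<ge> \<lambda>\<^sub>1 \<integral>\<^sub>\<Omega> u\<^sup>2 \<ge> \<integral>\<^sub>\<Omega> u\<^sup>2\<close>. Hence \<open>\<integral>\<^sub>\<Omega> |u|\<^sup>p \<le> 0\<close> and \<open>u\<close> vanishes almost everywhere.
\<close>

text \<open>Fubini for null sets. The argument runs in \<open>lborel\<close>, where the measure on
  pairs is the product measure by \<open>lborel_prod\<close>; Lebesgue measure on pairs is the
  completion of that product. It serves to kill the double integral when \<open>u\<close> vanishes
  almost everywhere.\<close>

lemma AE_lebesgue_prod:
  fixes P :: "'a::euclidean_space \<Rightarrow> bool"
  assumes "AE x in lebesgue. P x"
  shows "AE z in (lebesgue :: ('a \<times> 'a) measure). P (fst z) \<and> P (snd z)"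
proof -
  have "AE x in lborel. P x"
    using assms by (simp add: AE_completion_iff)
  \<comment> \<open>The exceptional set itself need not be Borel, so a Borel null set
    \<open>N\<close> covering it is used to make the set of good pairs measurable.\<close>
  then obtain N where N: "{x. \<not> P x} \<subseteq> N" "N \<in> null_sets lborel"
    by (auto simp: eventually_ae_filter)
  then have [measurable]: "N \<in> sets borel" by auto
  have "AE x in lborel. x \<notin> N"
    using N(2) by (rule AE_not_in)
  then have AE2: "AE x in lborel. AE y in lborel. x \<notin> N \<and> y \<notin> N"
    by (auto elim!: eventually_mono)
  have "AE z in lborel \<Otimes>\<^sub>M lborel. fst z \<notin> N \<and> snd z \<notin> N"
  proof (rule lborel_pair.AE_pair_measure)
    show "{z \<in> space (lborel \<Otimes>\<^sub>M lborel). fst z \<notin> N \<and> snd z \<notin> N} \<in> sets (lborel \<Otimes>\<^sub>M lborel)"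
      by measurable
  qed (use AE2 in simp)
  then have "AE z in lebesgue. fst z \<notin> N \<and> snd (z :: 'a \<times> 'a) \<notin> N"
    unfolding lborel_prod by (simp add: AE_completion_iff)
  then show ?thesis
    by (rule eventually_mono) (use N(1) in auto)
qed

text \<open>Since cos \<le> 1, the integrand is nonnegative. If the integral diverges, it and its
  inverse are 0 by convention, so the bound holds for every real \<open>r\<close>.\<close>

lemma frac_const_nonneg: "0 \<le> frac_const TYPE('a::euclidean_space) r"
  unfolding frac_const_def by (auto intro!: integral_nonneg_AE AE_I2)

lemma X0_norm_power2: "(X0_norm r u)\<^sup>2 = frac_form r u u"
proof -
  have "0 \<le> frac_const TYPE('a) r / 2 * (LINT z|lebesgue. (case z of (x, y) \<Rightarrow>
          \<bar>u x - u y\<bar>\<^sup>2 / norm (x - y) powr (real DIM('a) + 2 * r)))"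
    by (intro mult_nonneg_nonneg integral_nonneg_AE AE_I2)
       (auto simp: frac_const_nonneg split: prod.split)
  then show ?thesis
    by (simp add: X0_norm_def frac_form_def power2_eq_square)
qed

lemma frac_form_scale: "frac_form r (\<lambda>x. c * u x) (\<lambda>x. c * u x) = c\<^sup>2 * frac_form r u u"
proof -
  have "(\<lambda>z. case z of (x, y) \<Rightarrow>
          (c * u x - c * u y) * (c * u x - c * u y) / norm (x - y) powr (real DIM('a) + 2 * r)) =
        (\<lambda>z. c\<^sup>2 * (case z of (x, y) \<Rightarrow>
          (u x - u y) * (u x - u y) / norm (x - y) powr (real DIM('a) + 2 * r)))"
    by (auto simp: fun_eq_iff power2_eq_square right_diff_distrib[symmetric] mult_ac)
  then show ?thesis
    by (simp add: frac_form_def)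
qed

lemma X0_scale:
  assumes "u \<in> X0 \<Omega> r"
  shows "(\<lambda>x. c * u x) \<in> X0 \<Omega> r"
proof -
  have eq: "(\<lambda>(x, y). \<bar>c * u x - c * u y\<bar>\<^sup>2 / norm (x - y) powr (real DIM('a) + 2 * r)) =
        (\<lambda>z. c\<^sup>2 * (case z of (x, y) \<Rightarrow>
          \<bar>u x - u y\<bar>\<^sup>2 / norm (x - y) powr (real DIM('a) + 2 * r)))"
    by (auto simp: fun_eq_iff power_mult_distrib right_diff_distrib[symmetric])
  from assms show ?thesis
    unfolding X0_def Hr_def mem_Collect_eq eq by (auto simp: power_mult_distrib)
qed

text \<open>Both sides are homogeneous of degree 2 in \<open>u\<close>, so it suffices to rescale
  \<open>u\<close> to unit mass by \<open>c\<close>; the rescaled function is a competitor in the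
  infimum.\<close>

lemma lambda1_le_Rayleigh:
  assumes "u \<in> X0 \<Omega> r" "0 < (LINT x:\<Omega>|lebesgue. (u x)\<^sup>2)"
  shows "lambda1 \<Omega> r * (LINT x:\<Omega>|lebesgue. (u x)\<^sup>2) \<le> frac_form r u u"
proof -
  define m where "m = (LINT x:\<Omega>|lebesgue. (u x)\<^sup>2)"
  define c where "c = 1 / sqrt m"
  have m: "0 < m" and c2: "c\<^sup>2 = 1 / m"
    using assms(2) by (auto simp: m_def c_def power_divide)
  have "(LINT x:\<Omega>|lebesgue. (c * u x)\<^sup>2) = c\<^sup>2 * m"
    by (simp add: m_def power_mult_distrib)
  then have "L2_norm_on \<Omega> (\<lambda>x. c * u x) = 1"
    using m by (simp add: L2_norm_on_def c2)
  then have "lambda1 \<Omega> r \<le> (X0_norm r (\<lambda>x. c * u x))\<^sup>2"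
    unfolding lambda1_def using X0_scale[OF assms(1), of c]
    \<comment> \<open>All competitors are squares, so 0 bounds the set from below, as the real
      infimum requires.\<close>
    by (intro cInf_lower bdd_belowI[of _ 0]) auto
  also have "\<dots> = frac_form r u u / m"
    by (simp add: X0_norm_power2 frac_form_scale c2)
  finally show ?thesis
    using m by (simp add: field_simps flip: m_def)
qed

lemma beta_mult_self: "beta p s * s = \<bar>s\<bar> powr p"
\<comment> \<open>At \<open>s = 0\<close> both sides are 0 for every \<open>p\<close>, by the
  convention that \<open>0 powr p\<close> is 0.\<close>
proof (cases "s = 0")
  case False
  have "beta p s * s = \<bar>s\<bar> powr (p - 1) * \<bar>s\<bar> powr 1"
    by (simp add: beta_def sgn_if)
  then show ?thesis
    by (simp only: powr_add[symmetric]) simp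
qed (simp add: beta_def)

lemma weak_solution_imp_AE_zero:
  assumes \<Omega>: "open \<Omega>" and \<lambda>: "lambda1 \<Omega> \<sigma> \<ge> 1" and u: "weak_solution \<Omega> \<sigma> p u"
  shows "AE x in lebesgue. u x = 0"
proof -
  have uE: "u \<in> E_space \<Omega> \<sigma> p" and uX: "u \<in> X0 \<Omega> \<sigma>"
    using u by (auto simp: weak_solution_def E_space_def)
  have [measurable]: "\<Omega> \<in> sets lebesgue"
    using \<Omega> by auto
  \<comment> \<open>Integrability is what later lets a zero integral force a zero integrand, since a
    non-integrable function also has integral 0 by convention.\<close>
  have int: "set_integrable lebesgue \<Omega> (\<lambda>x. \<bar>u x\<bar> powr p)"
    using uE unfolding set_integrable_def
    by (intro integrable_mult_indicator) (auto simp: E_space_def)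
  define m where "m = (LINT x:\<Omega>|lebesgue. (u x)\<^sup>2)"
  have test: "frac_form \<sigma> u u + (LINT x:\<Omega>|lebesgue. \<bar>u x\<bar> powr p) - m = 0"
    using u uE by (auto simp: weak_solution_def beta_mult_self m_def power2_eq_square)
  have "0 \<le> m"
    unfolding m_def set_lebesgue_integral_def by (intro integral_nonneg_AE AE_I2) auto
  moreover have "0 \<le> frac_form \<sigma> u u"
    by (simp flip: X0_norm_power2)
  \<comment> \<open>Normalising \<open>u\<close> requires \<open>0 < m\<close>. For
    \<open>m = 0\<close> the nonnegativity of the form gives the same inequality.\<close>
  moreover have "m \<le> frac_form \<sigma> u u" if "0 < m"
  proof -
    have "1 * m \<le> lambda1 \<Omega> \<sigma> * m"
      using \<lambda> that by (intro mult_right_mono) auto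
    also have "\<dots> \<le> frac_form \<sigma> u u"
      using lambda1_le_Rayleigh[OF uX] that unfolding m_def by auto
    finally show ?thesis by simp
  qed
  ultimately have "(LINT x:\<Omega>|lebesgue. \<bar>u x\<bar> powr p) \<le> 0"
    using test by (cases "m = 0") auto
  moreover have "0 \<le> (LINT x:\<Omega>|lebesgue. \<bar>u x\<bar> powr p)"
    unfolding set_lebesgue_integral_def by (intro integral_nonneg_AE AE_I2) auto
  ultimately have "(LINT x:\<Omega>|lebesgue. \<bar>u x\<bar> powr p) = 0"
    by simp
  then have "AE x in lebesgue. indicator \<Omega> x *\<^sub>R (\<bar>u x\<bar> powr p) = 0"
    using int unfolding set_lebesgue_integral_def set_integrable_def
    by (subst (asm) integral_nonneg_eq_0_iff_AE) auto
  moreover have "AE x in lebesgue. x \<notin> \<Omega> \<longrightarrow> u x = 0"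
    using uX by (auto simp: X0_def)
  ultimately show ?thesis
    by eventually_elim (auto simp: indicator_def split: if_splits)
qed

text \<open>Every integrand in the definition, including those testing membership in
  \<open>E_space\<close>, vanishes almost everywhere.\<close>

lemma AE_zero_imp_weak_solution:
  assumes u: "AE x in lebesgue. u x = 0"
  shows "weak_solution \<Omega> \<sigma> p u"
proof -
  have integrable_AE_zero: "integrable lebesgue f" if "AE x in lebesgue. f x = 0"
    for f :: "'b::euclidean_space \<Rightarrow> real"
  proof -
    have "AE x in lebesgue. 0 = f x"
      using that by eventually_elim simp
    \<comment> \<open>Completeness of Lebesgue measure: a function equal almost everywhere to a
      measurable one is measurable.\<close>
    then have "f \<in> borel_measurable lebesgue"
      by (rule borel_measurable_AE[rotated]) simp
    then show ?thesis
      using that by (subst integrable_cong_AE[where g = "\<lambda>_. 0"]) auto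
  qed
  have pair: "AE z in lebesgue. u (fst z) = 0 \<and> u (snd z) = 0"
    using u by (rule AE_lebesgue_prod)
  have "u \<in> borel_measurable lebesgue"
    using integrable_AE_zero[OF u] by auto
  moreover have "integrable lebesgue (\<lambda>x. (u x)\<^sup>2)"
    using u by (intro integrable_AE_zero) (auto elim: eventually_mono)
  moreover have "integrable lebesgue
      (\<lambda>(x, y). \<bar>u x - u y\<bar>\<^sup>2 / norm (x - y) powr (real DIM('a) + 2 * \<sigma>))"
    using pair by (intro integrable_AE_zero) (auto elim: eventually_mono)
  moreover have "integrable lebesgue (\<lambda>x. \<bar>u x\<bar> powr p)"
    using u by (intro integrable_AE_zero) (auto elim: eventually_mono)
  ultimately have "u \<in> E_space \<Omega> \<sigma> p"
    using u by (auto simp: E_space_def X0_def Hr_def elim: eventually_mono)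
  moreover have "frac_form \<sigma> u \<phi> = 0" for \<phi>
    unfolding frac_form_def using pair
    by (subst integral_eq_zero_AE) (auto elim: eventually_mono)
  moreover have "(LINT x:\<Omega>|lebesgue. beta p (u x) * \<phi> x) = 0" for \<phi>
    unfolding set_lebesgue_integral_def using u
    by (intro integral_eq_zero_AE) (auto simp: beta_def elim: eventually_mono)
  moreover have "(LINT x:\<Omega>|lebesgue. u x * \<phi> x) = 0" for \<phi>
    unfolding set_lebesgue_integral_def using u
    by (intro integral_eq_zero_AE) (auto elim: eventually_mono)
  ultimately show ?thesis
    by (simp add: weak_solution_def)
qed

theorem corollary6p1:
  fixes \<Omega> :: "'a::euclidean_space set" and \<sigma> p :: real
  assumes "bounded_smooth_domain \<Omega>"
    and "0 < \<sigma>" and "\<sigma> < 1"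
    and "2 < p"
    and "lambda1 \<Omega> \<sigma> \<ge> 1"
  shows "\<forall>u. weak_solution \<Omega> \<sigma> p u \<longleftrightarrow> (AE x in lebesgue. u x = 0)"
  using assms weak_solution_imp_AE_zero AE_zero_imp_weak_solution
  unfolding bounded_smooth_domain_def by blast

end
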